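(* Let $A=(x,y,z)$ be a point of the Heisenberg group with the Lorentzian metric $\mathbb H^1_L$ such that $x>0$ (respectively $x<0$), $-x^2+y^2<0$ and $\frac{4|z|}{x^2-y^2}<1$. Then there is a unique timelike future directed (respectively past directed) geodesic joining $O=(0,0,0)$ with the point $A$. Let $\theta$ be a solution of the equation $$\frac{4z}{-x^2+y^2}=\frac{|\theta|/2}{\sinh^2(|\theta|/2)}-\coth(|\theta|/2).$$ Then the equations of the timelike future directed geodesic $\gamma=(x(t),y(t),z(t)):[0,1]\to\mathbb H^1_L$ are $$x(t)=\sinh^2\!\big(\tfrac{|\theta|}{2}t\big)\Big(x\big(\coth(\tfrac{|\theta|}{2}t)\coth(\tfrac{|\theta|}{2})-1\big)+y\big(\coth(\tfrac{|\theta|}{2}t)-\coth(\tfrac{|\theta|}{2})\big)\Big),$$ $$y(t)=\sinh^2\!\big(\tfrac{|\theta|}{2}t\big)\Big(y\big(\coth(\tfrac{|\theta|}{2}t)\coth(\tfrac{|\theta|}{2})-1\big)+x\big(\coth(\tfrac{|\theta|}{2}t)-\coth(\tfrac{|\theta|}{2})\big)\Big),$$ $$z(t)=z\,\frac{|\theta|t-\sinh(|\theta|t)}{|\theta|-\sinh(|\theta|)}.$$ The square of the length of these geodesics is $$l^2=\theta^2\,\frac{\big|\|h(1)\|^2\big|+4|z|}{2\Big(\big||\theta|-\sinh(|\theta|)\big|+2\sinh^2(|\theta|/2)\Big)},$$ where $\|h(t)\|^2=-x^2(t)+y^2(t)$, so that $\|h(1)\|^2=-x^2+y^2$.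
   Context: The Heisenberg group with the Lorentzian metric, $\mathbb H^1_L$, is $\mathbb R^3$ with coordinates $(x,y,z)$, the horizontal bundle spanned by $$X=\partial_x+\tfrac12 y\,\partial_z,\qquad Y=\partial_y-\tfrac12 x\,\partial_z,$$ and the Lorentzian metric $Q$ on it given by $Q(X,X)=-1$, $Q(Y,Y)=1$, $Q(X,Y)=0$. The time orientation is given by $X$. A horizontal vector $v$ is timelike if $Q(v,v)<0$; a timelike $v$ is future directed if $Q(v,X)<0$ and past directed if $Q(v,X)>0$. A curve has one of these properties if its tangent vectors do. A geodesic is the projection to $(x,y,z)$-space of a solution of the Hamiltonian system $\dot x=\partial_\xi H$, $\dot y=\partial_\eta H$, $\dot z=\partial_\theta H$, $\dot\xi=-\partial_xH$, $\dot\eta=-\partial_yH$, $\dot\theta=-\partial_zH$ with $$H(\xi,\eta,\theta,x,y,z)=\tfrac12(-\xi^2+\eta^2)-\tfrac18(-x^2+y^2)\theta^2+\tfrac12(-y\xi-x\eta)\theta.$$ Geodesics joining $O$ with $A$ are parametrized on $[0,1]$. The length of a curve $c$ on $[0,1]$ is $\int_0^1|Q(\dot c,\dot c)|^{1/2}dt$. *)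

theory Defs
  imports "HOL-Analysis.Analysis" "HOL-Library.FuncSet" "HOL-Real_Asymp.Real_Asymp"
begin

type_synonym point = "real \<times> real \<times> real"

fun X :: "point \<Rightarrow> point" where
  "X (x, y, z) = (1, 0, y / 2)"

fun Y :: "point \<Rightarrow> point" where
  "Y (x, y, z) = (0, 1, - x / 2)"

definition horizontal :: "point \<Rightarrow> point \<Rightarrow> bool" where
  "horizontal p v \<longleftrightarrow> v \<in> span {X p, Y p}"

(* A horizontal vector a X + b Y has a as its first and b as its second component,
   at every base point; hence no base point argument. Only meaningful on horizontal
   vectors. *)
fun Q :: "point \<Rightarrow> point \<Rightarrow> real" where
  "Q (a, b, c) (a', b', c') = - a * a' + b * b'"

lemma Q_frame:
  "Q (X p) (X p) = -1" "Q (Y p) (Y p) = 1" "Q (X p) (Y p) = 0"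
  by (cases p; simp)+

lemma bilinear_Q: "bilinear Q"
  unfolding bilinear_def by (auto intro!: linearI simp: algebra_simps)

definition timelike :: "point \<Rightarrow> point \<Rightarrow> bool" where
  "timelike p v \<longleftrightarrow> horizontal p v \<and> Q v v < 0"

definition future_directed :: "point \<Rightarrow> point \<Rightarrow> bool" where
  "future_directed p v \<longleftrightarrow> Q v (X p) < 0"

definition past_directed :: "point \<Rightarrow> point \<Rightarrow> bool" where
  "past_directed p v \<longleftrightarrow> Q v (X p) > 0"

definition timelike_future_curve :: "(real \<Rightarrow> point) \<Rightarrow> bool" where
  "timelike_future_curve \<gamma> \<longleftrightarrow>
     (\<forall>t\<in>{0..1}. \<exists>v. (\<gamma> has_vector_derivative v) (at t within {0..1}) \<and>
        timelike (\<gamma> t) v \<and> future_directed (\<gamma> t) v)"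

definition timelike_past_curve :: "(real \<Rightarrow> point) \<Rightarrow> bool" where
  "timelike_past_curve \<gamma> \<longleftrightarrow>
     (\<forall>t\<in>{0..1}. \<exists>v. (\<gamma> has_vector_derivative v) (at t within {0..1}) \<and>
        timelike (\<gamma> t) v \<and> past_directed (\<gamma> t) v)"

definition Ham :: "real \<Rightarrow> real \<Rightarrow> real \<Rightarrow> real \<Rightarrow> real \<Rightarrow> real \<Rightarrow> real" where
  "Ham \<xi> \<eta> \<theta> x y z =
     1/2 * (- \<xi>\<^sup>2 + \<eta>\<^sup>2) - 1/8 * (- x\<^sup>2 + y\<^sup>2) * \<theta>\<^sup>2 + 1/2 * (- y * \<xi> - x * \<eta>) * \<theta>"

definition hamiltonian_solution ::
  "(real \<Rightarrow> real) \<Rightarrow> (real \<Rightarrow> real) \<Rightarrow> (real \<Rightarrow> real) \<Rightarrow>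
   (real \<Rightarrow> real) \<Rightarrow> (real \<Rightarrow> real) \<Rightarrow> (real \<Rightarrow> real) \<Rightarrow> bool" where
  "hamiltonian_solution \<xi> \<eta> \<theta> x y z \<longleftrightarrow> (\<forall>t\<in>{0..1}.
     (x has_real_derivative deriv (\<lambda>s. Ham s (\<eta> t) (\<theta> t) (x t) (y t) (z t)) (\<xi> t))
       (at t within {0..1}) \<and>
     (y has_real_derivative deriv (\<lambda>s. Ham (\<xi> t) s (\<theta> t) (x t) (y t) (z t)) (\<eta> t))
       (at t within {0..1}) \<and>
     (z has_real_derivative deriv (\<lambda>s. Ham (\<xi> t) (\<eta> t) s (x t) (y t) (z t)) (\<theta> t))
       (at t within {0..1}) \<and>
     (\<xi> has_real_derivative - deriv (\<lambda>s. Ham (\<xi> t) (\<eta> t) (\<theta> t) s (y t) (z t)) (x t))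
       (at t within {0..1}) \<and>
     (\<eta> has_real_derivative - deriv (\<lambda>s. Ham (\<xi> t) (\<eta> t) (\<theta> t) (x t) s (z t)) (y t))
       (at t within {0..1}) \<and>
     (\<theta> has_real_derivative - deriv (\<lambda>s. Ham (\<xi> t) (\<eta> t) (\<theta> t) (x t) (y t) s) (z t))
       (at t within {0..1}))"

definition geodesic :: "(real \<Rightarrow> point) \<Rightarrow> bool" where
  "geodesic \<gamma> \<longleftrightarrow>
     (\<exists>\<xi> \<eta> \<theta> x y z. hamiltonian_solution \<xi> \<eta> \<theta> x y z \<and> (\<forall>t\<in>{0..1}. \<gamma> t = (x t, y t, z t)))"

definition geodesic_joining :: "point \<Rightarrow> point \<Rightarrow> (real \<Rightarrow> point) \<Rightarrow> bool" where
  "geodesic_joining p q \<gamma> \<longleftrightarrow> geodesic \<gamma> \<and> \<gamma> 0 = p \<and> \<gamma> 1 = q"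

definition curve_length :: "(real \<Rightarrow> point) \<Rightarrow> real" where
  "curve_length \<gamma> = integral {0..1}
     (\<lambda>t. let v = vector_derivative \<gamma> (at t within {0..1}) in \<bar>Q v v\<bar> powr (1/2))"

(* Only meaningful for u \<noteq> 0; coth 0 = 0 by division by zero. *)
definition coth :: "real \<Rightarrow> real" where
  "coth u = cosh u / sinh u"

(* The formulas below, as functions of \<theta>, have a removable singularity at \<theta> = 0 (the value
   that belongs to end points with z = 0); there they are read as their limits. For
   \<theta> \<noteq> 0 nothing is changed. *)
definition cont_ext :: "(real \<Rightarrow> real) \<Rightarrow> real \<Rightarrow> real" where
  "cont_ext f \<theta> = (if \<theta> = 0 then Lim (at 0) f else f \<theta>)"

(* At t = 0 the factor sinh\<^sup>2 makes geo_x and geo_y equal to 0, their limit for t \<rightarrow> 0,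
   whatever the value of coth 0. *)
definition geo_x :: "real \<Rightarrow> real \<Rightarrow> real \<Rightarrow> real \<Rightarrow> real" where
  "geo_x x y \<theta> t = cont_ext (\<lambda>\<theta>. (sinh (\<bar>\<theta>\<bar>/2 * t))\<^sup>2 *
     (x * (coth (\<bar>\<theta>\<bar>/2 * t) * coth (\<bar>\<theta>\<bar>/2) - 1) + y * (coth (\<bar>\<theta>\<bar>/2 * t) - coth (\<bar>\<theta>\<bar>/2)))) \<theta>"

definition geo_y :: "real \<Rightarrow> real \<Rightarrow> real \<Rightarrow> real \<Rightarrow> real" where
  "geo_y x y \<theta> t = cont_ext (\<lambda>\<theta>. (sinh (\<bar>\<theta>\<bar>/2 * t))\<^sup>2 *
     (y * (coth (\<bar>\<theta>\<bar>/2 * t) * coth (\<bar>\<theta>\<bar>/2) - 1) + x * (coth (\<bar>\<theta>\<bar>/2 * t) - coth (\<bar>\<theta>\<bar>/2)))) \<theta>"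

definition geo_z :: "real \<Rightarrow> real \<Rightarrow> real \<Rightarrow> real" where
  "geo_z z \<theta> t = cont_ext (\<lambda>\<theta>. z * ((\<bar>\<theta>\<bar> * t - sinh (\<bar>\<theta>\<bar> * t)) / (\<bar>\<theta>\<bar> - sinh \<bar>\<theta>\<bar>))) \<theta>"

lemma at_0_abs: "filterlim f F (at_right (0::real)) \<Longrightarrow> filterlim (\<lambda>\<theta>. f \<bar>\<theta>\<bar>) F (at 0)"
  by (rule filterlim_compose[where g = f]) (assumption, real_asymp)

lemma cont_ext_0:
  assumes "(f \<longlongrightarrow> l) (at 0)"
  shows "cont_ext f 0 = l"
  using tendsto_Lim[OF _ assms] by (simp add: cont_ext_def)

lemma geo_x_0: "geo_x x y 0 t = x * t"
proof (cases "t = 0")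
  case False
  have A: "((\<lambda>\<theta>::real. (sinh (\<theta>/2 * t))\<^sup>2 * (coth (\<theta>/2 * t) * coth (\<theta>/2) - 1)) \<longlongrightarrow> t) (at_right 0)"
    using False unfolding coth_def sinh_field_def cosh_field_def
    by (cases "t > 0"; (real_asymp, simp add: power2_eq_square))
  have B: "((\<lambda>\<theta>::real. (sinh (\<theta>/2 * t))\<^sup>2 * (coth (\<theta>/2 * t) - coth (\<theta>/2))) \<longlongrightarrow> 0) (at_right 0)"
    using False unfolding coth_def sinh_field_def cosh_field_def
    by (cases "t > 0"; real_asymp)
  have "((\<lambda>\<theta>. (sinh (\<theta>/2 * t))\<^sup>2 *
     (x * (coth (\<theta>/2 * t) * coth (\<theta>/2) - 1) + y * (coth (\<theta>/2 * t) - coth (\<theta>/2))))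
       \<longlongrightarrow> x * t) (at_right 0)"
    using tendsto_add[OF tendsto_mult_left[OF A, of x] tendsto_mult_left[OF B, of y]]
    by (simp add: algebra_simps)
  from at_0_abs[OF this] show ?thesis
    unfolding geo_x_def by (intro cont_ext_0) simp
qed (auto simp: geo_x_def intro!: cont_ext_0)

lemma geo_y_0: "geo_y x y 0 t = y * t"
  using geo_x_0[of y x t] by (simp add: geo_x_def geo_y_def)

lemma geo_z_0: "geo_z 0 0 t = 0"
  by (auto simp: geo_z_def intro!: cont_ext_0)

lemma angle_function_0: "cont_ext (\<lambda>\<theta>. (\<bar>\<theta>\<bar>/2) / (sinh (\<bar>\<theta>\<bar>/2))\<^sup>2 - coth (\<bar>\<theta>\<bar>/2)) 0 = 0"
proof -
  have "((\<lambda>u::real. (u - (exp (2*u) - exp (- (2*u))) / 4) / ((exp u - exp (-u)) / 2)\<^sup>2) \<longlongrightarrow> 0) (at_right 0)"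
    by real_asymp
  moreover have "(u - (exp (2*u) - exp (- (2*u))) / 4) / ((exp u - exp (-u)) / 2)\<^sup>2
      = u / (sinh u)\<^sup>2 - coth u" for u :: real
  proof -
    have "(exp (2*u) - exp (- (2*u))) / 4 = sinh u * cosh u"
      using sinh_double[of u] by (simp add: sinh_field_def)
    then show ?thesis
      by (cases "sinh u = 0") (auto simp: coth_def sinh_field_def[symmetric] field_simps power2_eq_square)
  qed
  ultimately have "((\<lambda>u::real. u / (sinh u)\<^sup>2 - coth u) \<longlongrightarrow> 0) (at_right 0)"
    by simp
  moreover have "filterlim (\<lambda>\<theta>::real. \<theta>/2) (at_right 0) (at_right 0)"
    by real_asymp
  ultimately have "((\<lambda>\<theta>::real. (\<theta>/2) / (sinh (\<theta>/2))\<^sup>2 - coth (\<theta>/2)) \<longlongrightarrow> 0) (at_right 0)"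
    by (rule filterlim_compose)
  from at_0_abs[OF this] show ?thesis
    by (rule cont_ext_0)
qed

lemma length_formula_0:
  "cont_ext (\<lambda>\<theta>. \<theta>\<^sup>2 * (a / (2 * (\<bar>\<bar>\<theta>\<bar> - sinh \<bar>\<theta>\<bar>\<bar> + 2 * (sinh (\<bar>\<theta>\<bar>/2))\<^sup>2)))) 0 = a"
proof -
  have "((\<lambda>\<theta>::real. \<theta>\<^sup>2 / (2 * (\<bar>\<theta> - sinh \<theta>\<bar> + 2 * (sinh (\<theta>/2))\<^sup>2))) \<longlongrightarrow> 1) (at_right 0)"
    unfolding sinh_field_def by (real_asymp simp: power2_eq_square)
  from tendsto_mult_left[OF at_0_abs[OF this], of a] show ?thesis
    by (intro cont_ext_0) (simp add: mult.commute)
qed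

end

theory Submission
  imports Defs
begin

text \<open>The momentum \<open>\<theta>\<close> is constant, and so are \<open>x' + \<theta> y\<close> and \<open>y' + \<theta> x\<close>. In the
  light-cone coordinates \<open>x + y\<close> and \<open>x - y\<close> the system therefore decouples into two scalar linear
  equations, and the end point determines their solutions for given \<open>\<theta>\<close>: \<open>x - y\<close> evolves by the
  increasing factor \<open>profile \<theta> t\<close>, and \<open>x + y\<close> by \<open>profile (- \<theta>) t\<close>. The coordinate \<open>z\<close> is then
  \<open>(x\<^sup>2 - y\<^sup>2) / 4\<close> times \<open>height \<theta> t\<close>. Since \<open>\<theta> \<mapsto> height \<theta> 1\<close> is an odd increasing bijection
  onto the interval from \<open>-1\<close> to \<open>1\<close>, the height of the end point fixes \<open>\<theta>\<close>. The speed is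
  constant along the curve, which gives the length.\<close>

section \<open>Model curves and the scalar functions they are built from\<close>

definition profile :: "real \<Rightarrow> real \<Rightarrow> real" where
  "profile \<theta> t = (if \<theta> = 0 then t else (exp (\<theta> * t) - 1) / (exp \<theta> - 1))"

text \<open>The velocity of \<open>profile \<theta>\<close> at \<open>t = 0\<close>. Both
  definitions take the limit of the general formula as their value at
  \<open>\<theta> = 0\<close>.\<close>

definition slope :: "real \<Rightarrow> real" where
  "slope \<theta> = (if \<theta> = 0 then 1 else \<theta> / (exp \<theta> - 1))"

text \<open>Division by zero makes \<^term>\<open>height 0 t = 0\<close>, which is the value needed for straight
  geodesics.\<close>

definition height :: "real \<Rightarrow> real \<Rightarrow> real" where
  "height \<theta> t = (sinh (\<theta> * t) - \<theta> * t) / (cosh \<theta> - 1)"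

text \<open>The first two components come from solving for \<open>x\<close> and \<open>y\<close>
  after \<open>x + y\<close> and \<open>x - y\<close> have been scaled by their factors. At
  \<open>t = 1\<close> they equal \<open>x\<close> and \<open>y\<close> for every
  \<open>\<theta>\<close>, so only the third component there depends on
  \<open>\<theta>\<close>.\<close>

definition model_curve :: "real \<Rightarrow> real \<Rightarrow> real \<Rightarrow> real \<Rightarrow> point" where
  "model_curve x y \<theta> t =
     (((x + y) * profile (- \<theta>) t + (x - y) * profile \<theta> t) / 2,
      ((x + y) * profile (- \<theta>) t - (x - y) * profile \<theta> t) / 2,
      (x\<^sup>2 - y\<^sup>2) / 4 * height \<theta> t)"

text \<open>The velocity is kept in exponential form because the exponentials cancel in the product
  of the two light-cone velocities.\<close>

definition model_vx :: "real \<Rightarrow> real \<Rightarrow> real \<Rightarrow> real \<Rightarrow> real" where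
  "model_vx x y \<theta> t =
     ((x + y) * (slope (- \<theta>) * exp (- \<theta> * t)) + (x - y) * (slope \<theta> * exp (\<theta> * t))) / 2"

definition model_vy :: "real \<Rightarrow> real \<Rightarrow> real \<Rightarrow> real \<Rightarrow> real" where
  "model_vy x y \<theta> t =
     ((x + y) * (slope (- \<theta>) * exp (- \<theta> * t)) - (x - y) * (slope \<theta> * exp (\<theta> * t))) / 2"

lemma profile_0 [simp]: "profile \<theta> 0 = 0"
  by (simp add: profile_def)

lemma profile_1 [simp]: "profile \<theta> 1 = 1"
  by (simp add: profile_def)

lemma height_0 [simp]: "height \<theta> 0 = 0"
  by (simp add: height_def)

lemma height_angle_0 [simp]: "height 0 t = 0"
  by (simp add: height_def)

lemma slope_pos: "slope \<theta> > 0"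
  by (auto simp: slope_def zero_less_divide_iff)

text \<open>Up to the factor 2 and a sign, the denominator of \<open>height\<close> is the product
  of the denominators of \<open>profile \<theta>\<close> and
  \<open>profile (- \<theta>)\<close>.\<close>

lemma cosh_minus_1: "2 * (cosh \<theta> - 1) = (exp \<theta> - 1) * (1 - exp (- \<theta>))" for \<theta> :: real
  by (simp add: cosh_field_def algebra_simps flip: exp_add)

lemma cosh_minus_1_pos: "cosh \<theta> - 1 > 0" if "\<theta> \<noteq> 0" for \<theta> :: real
proof -
  have "cosh \<theta> \<noteq> 1"
    using that cosh_minus_1[of \<theta>] by auto
  then show ?thesis
    using cosh_real_ge_1[of \<theta>] by linarith
qed

lemma slope_mult: "slope \<theta> * slope (- \<theta>) = (if \<theta> = 0 then 1 else \<theta>\<^sup>2 / (2 * (cosh \<theta> - 1)))"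
  using minus_divide_divide[of \<theta> "1 - exp (- \<theta>)"]
  unfolding slope_def cosh_minus_1 by (simp add: power2_eq_square)

lemma profile_deriv:
  "(profile \<theta> has_real_derivative slope \<theta> * exp (\<theta> * t)) (at t within S)"
  unfolding profile_def
  by (cases "\<theta> = 0") (auto simp: slope_def intro!: derivative_eq_intros)

text \<open>Together with \<open>profile_deriv\<close> this says that
  \<open>profile \<theta>\<close> solves \<open>f' = c + \<theta> f\<close> with
  \<open>c = slope \<theta>\<close>.\<close>

lemma profile_ode: "slope \<theta> * exp (\<theta> * t) = slope \<theta> + \<theta> * profile \<theta> t"
  by (auto simp: slope_def profile_def divide_simps) (auto simp: algebra_simps)

text \<open>The derivative is the Wronskian of the two profiles, which is what horizontality
  prescribes for \<open>z'\<close> in light-cone coordinates, up to a constant factor.\<close>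

lemma height_deriv:
  "(height \<theta> has_real_derivative
      profile (- \<theta>) t * (slope \<theta> * exp (\<theta> * t)) - profile \<theta> t * (slope (- \<theta>) * exp (- \<theta> * t)))
    (at t within S)"
proof (cases "\<theta> = 0")
  case True
  then show ?thesis
    by (simp add: slope_def profile_def height_def[abs_def])
next
  case False
  have "(height \<theta> has_real_derivative (cosh (\<theta> * t) * \<theta> - \<theta>) / (cosh \<theta> - 1)) (at t within S)"
    unfolding height_def using cosh_minus_1_pos[OF False]
    by (auto intro!: derivative_eq_intros)
  moreover have "(cosh (\<theta> * t) * \<theta> - \<theta>) / (cosh \<theta> - 1) =
    profile (- \<theta>) t * (slope \<theta> * exp (\<theta> * t)) - profile \<theta> t * (slope (- \<theta>) * exp (- \<theta> * t))"
  proof -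
    have *: "(cosh (\<theta> * t) * \<theta> - \<theta>) / (cosh \<theta> - 1)
        = \<theta> * (2 * (cosh (\<theta> * t) - 1)) / (2 * (cosh \<theta> - 1))"
      by (subst mult.left_commute, subst mult_divide_mult_cancel_left) (simp_all add: algebra_simps)
    \<comment> \<open>By \<open>cosh_minus_1\<close>, \<open>a * b\<close> is
      \<open>2 * (cosh \<theta> - 1)\<close> and \<open>(e - 1) * (1 - e')\<close> is
      \<open>2 * (cosh (\<theta> * t) - 1)\<close>. The remaining identity then needs only
      \<open>e * e' = 1\<close>.\<close>
    define a b e e' where abs: "a = exp \<theta> - 1" "b = 1 - exp (- \<theta>)"
      "e = exp (\<theta> * t)" "e' = exp (- (\<theta> * t))"
    have nz: "a \<noteq> 0" "b \<noteq> 0" and ee: "e * e' = 1"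
      using False by (auto simp: abs simp flip: exp_add)
    have minus: "profile (- \<theta>) t = (1 - e') / b" "slope (- \<theta>) = \<theta> / b"
      using False minus_divide_divide[of "1 - e'" b] minus_divide_divide[of \<theta> b]
      by (simp_all add: profile_def slope_def abs)
    have plus: "profile \<theta> t = (e - 1) / a" "slope \<theta> = \<theta> / a"
      using False by (simp_all add: profile_def slope_def abs)
    have "\<theta> * ((e - 1) * (1 - e')) / (a * b)
        = \<theta> * ((1 - e') * e - (e - 1) * e') / (a * b)"
      using ee by (simp add: algebra_simps)
    also have "\<dots> = (1 - e') / b * (\<theta> / a * e) - (e - 1) / a * (\<theta> / b * e')"
      using nz by (simp add: field_simps)
    finally show ?thesis
      unfolding * cosh_minus_1 minus plus by (simp add: abs)
  qed
  ultimately show ?thesis by simp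
qed

section \<open>Uniqueness for the scalar linear equation\<close>

lemma eq_of_deriv_eq:
  fixes f g :: "real \<Rightarrow> real"
  assumes "\<And>t. t \<in> {0..1} \<Longrightarrow> (f has_real_derivative d t) (at t within {0..1})"
    and "\<And>t. t \<in> {0..1} \<Longrightarrow> (g has_real_derivative d t) (at t within {0..1})"
    and "f 0 = g 0" "t \<in> {0..1}"
  shows "f t = g t"
proof -
  have "\<exists>c. \<forall>s\<in>{0..1}. f s - g s = c"
    by (rule has_field_derivative_zero_constant)
      (use DERIV_diff[OF assms(1,2)] in auto)
  then have "f t - g t = f 0 - g 0"
    using assms(4) by (metis atLeastAtMost_iff order_refl zero_le_one)
  then show ?thesis
    using assms(3) by simp
qed

text \<open>The integrating factor \<open>exp (- \<theta> * t)\<close> solves the equation, and the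
  value at 1 replaces the unknown constant \<open>c\<close>.\<close>

lemma linear_ode_unique:
  fixes f :: "real \<Rightarrow> real"
  assumes "\<And>t. t \<in> {0..1} \<Longrightarrow> (f has_real_derivative c + \<theta> * f t) (at t within {0..1})"
    and "f 0 = 0"
  shows "c = f 1 * slope \<theta>" and "t \<in> {0..1} \<Longrightarrow> f t = f 1 * profile \<theta> t"
proof -
  have "c = f 1 * slope \<theta> \<and> (\<forall>t\<in>{0..1}. f t = f 1 * profile \<theta> t)"
  proof (cases "\<theta> = 0")
    case True
    have "f t = c * t" if "t \<in> {0..1}" for t
      by (rule eq_of_deriv_eq[where d = "\<lambda>_. c", OF _ _ _ that])
        (use assms True in \<open>auto intro!: derivative_eq_intros\<close>)
    then show ?thesis
      using True by (simp add: profile_def slope_def)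
  next
    case False
    \<comment> \<open>The left side has derivative 0 by the equation, and its value at
      \<open>t = 0\<close> is \<open>c\<close> because \<open>f 0 = 0\<close>.\<close>
    have *: "exp (- \<theta> * t) * (\<theta> * f t + c) = c" if "t \<in> {0..1}" for t
      by (rule eq_of_deriv_eq[where d = "\<lambda>_. 0", OF _ _ _ that])
        (use assms in \<open>auto intro!: derivative_eq_intros simp: algebra_simps\<close>)
    have **: "\<theta> * f t = c * (exp (\<theta> * t) - 1)" if "t \<in> {0..1}" for t
      using *[OF that] by (simp add: exp_minus field_simps)
    have c: "c = f 1 * slope \<theta>"
      using False **[of 1] by (simp add: slope_def eq_divide_eq mult.commute)
    have "f t = f 1 * profile \<theta> t" if "t \<in> {0..1}" for t
    proof -
      have "\<theta> * f t = \<theta> * (f 1 * profile \<theta> t)"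
        unfolding **[OF that] c using False by (simp add: slope_def profile_def)
      then show ?thesis
        using False by simp
    qed
    with c show ?thesis by blast
  qed
  then show "c = f 1 * slope \<theta>" and "t \<in> {0..1} \<Longrightarrow> f t = f 1 * profile \<theta> t"
    by blast+
qed

section \<open>Geodesics from the origin are model curves\<close>

text \<open>With the partial derivatives evaluated, the system shows \<open>\<theta>\<close>
  constant, \<open>\<xi>' = \<theta> / 2 * y'\<close> and
  \<open>\<eta>' = - \<theta> / 2 * x'\<close>. Hence \<open>\<xi>\<close> and \<open>\<eta>\<close>
  can be integrated at once.\<close>

lemma hamiltonian_solution_iff:
  "hamiltonian_solution \<xi> \<eta> \<theta> x y z \<longleftrightarrow> (\<forall>t\<in>{0..1}.
     (x has_real_derivative - \<xi> t - y t * \<theta> t / 2) (at t within {0..1}) \<and>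
     (y has_real_derivative \<eta> t - x t * \<theta> t / 2) (at t within {0..1}) \<and>
     (z has_real_derivative ((x t)\<^sup>2 - (y t)\<^sup>2) * \<theta> t / 4 - (y t * \<xi> t + x t * \<eta> t) / 2)
       (at t within {0..1}) \<and>
     (\<xi> has_real_derivative \<theta> t / 2 * (\<eta> t - x t * \<theta> t / 2)) (at t within {0..1}) \<and>
     (\<eta> has_real_derivative \<theta> t / 2 * (\<xi> t + y t * \<theta> t / 2)) (at t within {0..1}) \<and>
     (\<theta> has_real_derivative 0) (at t within {0..1}))"
proof -
  have 1: "deriv (\<lambda>s. Ham s e h a b c) k = - k - b * h / 2" for e h a b c k
    unfolding Ham_def
    by (rule DERIV_imp_deriv) (auto intro!: derivative_eq_intros simp: field_simps)
  have 2: "deriv (\<lambda>s. Ham k s h a b c) e = e - a * h / 2" for e h a b c k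
    unfolding Ham_def
    by (rule DERIV_imp_deriv) (auto intro!: derivative_eq_intros simp: field_simps)
  have 3: "deriv (\<lambda>s. Ham k e s a b c) h = (a\<^sup>2 - b\<^sup>2) * h / 4 - (b * k + a * e) / 2"
    for e h a b c k
    unfolding Ham_def
    by (rule DERIV_imp_deriv)
      (auto intro!: derivative_eq_intros simp: field_simps power2_eq_square)
  have 4: "- deriv (\<lambda>s. Ham k e h s b c) a = h / 2 * (e - a * h / 2)" for e h a b c k
  proof -
    have "deriv (\<lambda>s. Ham k e h s b c) a = - (h / 2 * (e - a * h / 2))"
      unfolding Ham_def
      by (rule DERIV_imp_deriv)
        (auto intro!: derivative_eq_intros simp: field_simps power2_eq_square)
    then show ?thesis by simp
  qed
  have 5: "- deriv (\<lambda>s. Ham k e h a s c) b = h / 2 * (k + b * h / 2)" for e h a b c k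
  proof -
    have "deriv (\<lambda>s. Ham k e h a s c) b = - (h / 2 * (k + b * h / 2))"
      unfolding Ham_def
      by (rule DERIV_imp_deriv)
        (auto intro!: derivative_eq_intros simp: field_simps power2_eq_square)
    then show ?thesis by simp
  qed
  have 6: "- deriv (\<lambda>s. Ham k e h a b s) c = 0" for e h a b c k
    by (simp add: Ham_def)
  show ?thesis
    unfolding hamiltonian_solution_def 1 2 3 4 5 6 ..
qed

text \<open>The first two end coordinates fix the curve up to the momentum \<open>\<theta>\<close>,
  which is later determined by comparing third coordinates at \<open>t = 1\<close>.\<close>

lemma geodesic_imp_model_curve:
  assumes "geodesic_joining (0, 0, 0) (x, y, z) \<gamma>"
  obtains \<theta> where "\<And>t. t \<in> {0..1} \<Longrightarrow> \<gamma> t = model_curve x y \<theta> t"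
proof -
  from assms obtain \<xi> \<eta> \<theta>' u v w where
    ham: "hamiltonian_solution \<xi> \<eta> \<theta>' u v w" and
    \<gamma>: "\<And>t. t \<in> {0..1} \<Longrightarrow> \<gamma> t = (u t, v t, w t)" and
    ends: "\<gamma> 0 = (0, 0, 0)" "\<gamma> 1 = (x, y, z)"
    by (auto simp: geodesic_joining_def geodesic_def)
  have bd: "u 0 = 0" "v 0 = 0" "w 0 = 0" "u 1 = x" "v 1 = y"
    using \<gamma>[of 0] \<gamma>[of 1] ends by auto
  define \<theta> where "\<theta> = \<theta>' 0"
  have D:
    "(u has_real_derivative - \<xi> t - v t * \<theta>' t / 2) (at t within {0..1})"
    "(v has_real_derivative \<eta> t - u t * \<theta>' t / 2) (at t within {0..1})"
    "(w has_real_derivative ((u t)\<^sup>2 - (v t)\<^sup>2) * \<theta>' t / 4 - (v t * \<xi> t + u t * \<eta> t) / 2)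
       (at t within {0..1})"
    "(\<xi> has_real_derivative \<theta>' t / 2 * (\<eta> t - u t * \<theta>' t / 2)) (at t within {0..1})"
    "(\<eta> has_real_derivative \<theta>' t / 2 * (\<xi> t + v t * \<theta>' t / 2)) (at t within {0..1})"
    "(\<theta>' has_real_derivative 0) (at t within {0..1})" if "t \<in> {0..1}" for t
    using ham that unfolding hamiltonian_solution_iff by auto
  have \<theta>: "\<theta>' t = \<theta>" if "t \<in> {0..1}" for t
    by (rule eq_of_deriv_eq[where d = "\<lambda>_. 0", OF _ _ _ that])
      (auto simp: \<theta>_def intro!: D)
  have \<xi>: "\<xi> t = \<theta> / 2 * v t + \<xi> 0" if "t \<in> {0..1}" for t
    by (rule eq_of_deriv_eq[OF D(4) _ _ that])
      (auto simp: \<theta> bd intro!: derivative_eq_intros D(2))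
  have \<eta>: "\<eta> t = \<eta> 0 - \<theta> / 2 * u t" if "t \<in> {0..1}" for t
    by (rule eq_of_deriv_eq[OF D(5) _ _ that])
      (auto simp: \<theta> bd field_simps intro!: derivative_eq_intros D(1))
  \<comment> \<open>Inserting the integrated momenta into the equations for \<open>u\<close> and
    \<open>v\<close> and then adding or subtracting decouples them. The rates are
    \<open>- \<theta>\<close> for the sum and \<open>\<theta>\<close> for the difference.\<close>
  have dp: "((\<lambda>t. u t + v t) has_real_derivative \<eta> 0 - \<xi> 0 + - \<theta> * (u t + v t)) (at t within {0..1})"
    if t: "t \<in> {0..1}" for t
    using DERIV_add[OF D(1)[OF t] D(2)[OF t]]
    by (rule DERIV_cong) (use \<xi>[OF t] \<eta>[OF t] \<theta>[OF t] in \<open>simp add: algebra_simps\<close>)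
  have dm: "((\<lambda>t. u t - v t) has_real_derivative - \<eta> 0 - \<xi> 0 + \<theta> * (u t - v t)) (at t within {0..1})"
    if t: "t \<in> {0..1}" for t
    using DERIV_diff[OF D(1)[OF t] D(2)[OF t]]
    by (rule DERIV_cong) (use \<xi>[OF t] \<eta>[OF t] \<theta>[OF t] in \<open>simp add: algebra_simps\<close>)
  have p: "\<eta> 0 - \<xi> 0 = (x + y) * slope (- \<theta>)"
    "u t + v t = (x + y) * profile (- \<theta>) t" if "t \<in> {0..1}" for t
    using linear_ode_unique[OF dp] that bd by auto
  have m: "- \<eta> 0 - \<xi> 0 = (x - y) * slope \<theta>"
    "u t - v t = (x - y) * profile \<theta> t" if "t \<in> {0..1}" for t
    using linear_ode_unique[OF dm] that bd by auto
  let ?D = "x\<^sup>2 - y\<^sup>2"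
  have w: "w t = ?D / 4 * height \<theta> t" if "t \<in> {0..1}" for t
  proof (rule eq_of_deriv_eq[OF D(3) _ _ that])
    fix s :: real assume s: "s \<in> {0..1}"
    define P where "P = profile (- \<theta>) s"
    define M where "M = profile \<theta> s"
    define P' where "P' = slope (- \<theta>) * exp (- \<theta> * s)"
    define M' where "M' = slope \<theta> * exp (\<theta> * s)"
    define u' where "u' = - \<xi> s - v s * \<theta> / 2"
    define v' where "v' = \<eta> s - u s * \<theta> / 2"
    have P: "u s + v s = (x + y) * P" and M: "u s - v s = (x - y) * M"
      using p[OF s] m[OF s] by (auto simp: P_def M_def)
    have "u' + v' = (\<eta> 0 - \<xi> 0) - \<theta> * (u s + v s)"
      using \<xi>[OF s] \<eta>[OF s] by (simp add: u'_def v'_def algebra_simps)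
    also have "\<dots> = (x + y) * P'"
      unfolding P p(1)[OF s] P'_def profile_ode P_def by (simp add: algebra_simps)
    finally have P': "u' + v' = (x + y) * P'" .
    have "u' - v' = (- \<eta> 0 - \<xi> 0) + \<theta> * (u s - v s)"
      using \<xi>[OF s] \<eta>[OF s] by (simp add: u'_def v'_def algebra_simps)
    also have "\<dots> = (x - y) * M'"
      unfolding M m(1)[OF s] M'_def profile_ode M_def by (simp add: algebra_simps)
    finally have M': "u' - v' = (x - y) * M'" .
    \<comment> \<open>The left side is \<open>(v * u' - u * v') / 2\<close>, the third component of
      a horizontal velocity, and the right side is the same expression in light-cone
      coordinates.\<close>
    have "((u s)\<^sup>2 - (v s)\<^sup>2) * \<theta> / 4 - (v s * \<xi> s + u s * \<eta> s) / 2
      = ((u s + v s) * (u' - v') - (u s - v s) * (u' + v')) / 4"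
      by (simp add: u'_def v'_def field_simps power2_eq_square)
    also have "\<dots> = ?D / 4 * (P * M' - M * P')"
      unfolding P M P' M' by (simp add: field_simps power2_eq_square)
    finally have *: "((u s)\<^sup>2 - (v s)\<^sup>2) * \<theta> / 4 - (v s * \<xi> s + u s * \<eta> s) / 2
      = ?D / 4 * (P * M' - M * P')" .
    show "((\<lambda>t. ?D / 4 * height \<theta> t) has_real_derivative
      ((u s)\<^sup>2 - (v s)\<^sup>2) * \<theta>' s / 4 - (v s * \<xi> s + u s * \<eta> s) / 2) (at s within {0..1})"
      unfolding \<theta>[OF s] * unfolding P_def M_def P'_def M'_def
      by (intro DERIV_cmult height_deriv)
  qed (auto simp: bd)
  show thesis
  proof
    fix t :: real assume t: "t \<in> {0..1}"
    show "\<gamma> t = model_curve x y \<theta> t"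
      using \<gamma>[OF t] p(2)[OF t] m(2)[OF t] w[OF t] by (simp add: model_curve_def)
  qed
qed

section \<open>Model curves are geodesics\<close>

lemma model_curve_derivs:
  fixes S :: "real set"
  shows "((\<lambda>t. ((x + y) * profile (- \<theta>) t + (x - y) * profile \<theta> t) / 2)
      has_real_derivative model_vx x y \<theta> t) (at t within S)"
    and "((\<lambda>t. ((x + y) * profile (- \<theta>) t - (x - y) * profile \<theta> t) / 2)
      has_real_derivative model_vy x y \<theta> t) (at t within S)"
  unfolding model_vx_def model_vy_def
  by (auto intro!: derivative_eq_intros profile_deriv)

lemma model_z_deriv:
  "((\<lambda>t. (x\<^sup>2 - y\<^sup>2) / 4 * height \<theta> t) has_real_derivative
     (((x + y) * profile (- \<theta>) t - (x - y) * profile \<theta> t) / 2 * model_vx x y \<theta> t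
      - ((x + y) * profile (- \<theta>) t + (x - y) * profile \<theta> t) / 2 * model_vy x y \<theta> t) / 2)
    (at t within S)"
  using DERIV_cmult[OF height_deriv[of \<theta> t S], of "(x\<^sup>2 - y\<^sup>2) / 4"]
  by (rule DERIV_cong) (simp add: model_vx_def model_vy_def field_simps power2_eq_square)

text \<open>The second assumption says that the third coordinate at \<open>t = 1\<close> is
  \<open>z\<close>. The momenta are reconstructed from the velocities.\<close>

lemma model_curve_geodesic:
  assumes "\<And>t. t \<in> {0..1} \<Longrightarrow> \<gamma> t = model_curve x y \<theta> t"
    and "(x\<^sup>2 - y\<^sup>2) * height \<theta> 1 = 4 * z"
  shows "geodesic_joining (0, 0, 0) (x, y, z) \<gamma>"
proof -
  let ?x = "\<lambda>t. ((x + y) * profile (- \<theta>) t + (x - y) * profile \<theta> t) / 2"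
  let ?y = "\<lambda>t. ((x + y) * profile (- \<theta>) t - (x - y) * profile \<theta> t) / 2"
  let ?z = "\<lambda>t. (x\<^sup>2 - y\<^sup>2) / 4 * height \<theta> t"
  \<comment> \<open>\<open>A\<close> and \<open>B\<close> are the initial velocities, which are also
    the constant values of \<open>x' + \<theta> y\<close> and
    \<open>y' + \<theta> x\<close>.\<close>
  define A where "A = ((x + y) * slope (- \<theta>) + (x - y) * slope \<theta>) / 2"
  define B where "B = ((x + y) * slope (- \<theta>) - (x - y) * slope \<theta>) / 2"
  have vx: "model_vx x y \<theta> t = A - \<theta> * ?y t" for t
    unfolding model_vx_def profile_ode A_def by (simp add: field_simps)
  have vy: "model_vy x y \<theta> t = B - \<theta> * ?x t" for t
    unfolding model_vy_def profile_ode B_def by (simp add: field_simps)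
  note dx = model_curve_derivs(1)[of x y \<theta> _ "{0..1}", unfolded vx]
  note dy = model_curve_derivs(2)[of x y \<theta> _ "{0..1}", unfolded vy]
  note dz = model_z_deriv[of x y \<theta> _ "{0..1}", unfolded vx vy]
  \<comment> \<open>The first two momenta come from solving
    \<open>x' = - \<xi> - y * \<theta> / 2\<close> and \<open>y' = \<eta> - x * \<theta> / 2\<close>
    for \<open>\<xi>\<close> and \<open>\<eta>\<close>.\<close>
  have "hamiltonian_solution (\<lambda>t. \<theta> / 2 * ?y t - A) (\<lambda>t. B - \<theta> / 2 * ?x t) (\<lambda>_. \<theta>) ?x ?y ?z"
    unfolding hamiltonian_solution_iff
  proof (intro ballI conjI)
    fix t :: real
    show "(?x has_real_derivative - (\<theta> / 2 * ?y t - A) - ?y t * \<theta> / 2) (at t within {0..1})"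
      by (rule DERIV_cong[OF dx]) (simp add: field_simps)
    show "(?y has_real_derivative (B - \<theta> / 2 * ?x t) - ?x t * \<theta> / 2) (at t within {0..1})"
      by (rule DERIV_cong[OF dy]) (simp add: field_simps)
    show "(?z has_real_derivative ((?x t)\<^sup>2 - (?y t)\<^sup>2) * \<theta> / 4
      - (?y t * (\<theta> / 2 * ?y t - A) + ?x t * (B - \<theta> / 2 * ?x t)) / 2) (at t within {0..1})"
      by (rule DERIV_cong[OF dz]) (simp add: algebra_simps power2_eq_square diff_divide_distrib add_divide_distrib)
    show "((\<lambda>t. \<theta> / 2 * ?y t - A) has_real_derivative \<theta> / 2 * (B - \<theta> / 2 * ?x t - ?x t * \<theta> / 2))
      (at t within {0..1})"
      by (rule DERIV_cong[OF DERIV_diff[OF DERIV_cmult[OF dy] DERIV_const]]) (simp add: field_simps)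
    show "((\<lambda>t. B - \<theta> / 2 * ?x t) has_real_derivative \<theta> / 2 * (\<theta> / 2 * ?y t - A + ?y t * \<theta> / 2))
      (at t within {0..1})"
      by (rule DERIV_cong[OF DERIV_diff[OF DERIV_const DERIV_cmult[OF dx]]]) (simp add: field_simps)
  qed simp
  moreover have "\<forall>t\<in>{0..1}. \<gamma> t = (?x t, ?y t, ?z t)"
    using assms(1) by (simp add: model_curve_def)
  ultimately have "geodesic \<gamma>"
    unfolding geodesic_def by (intro exI conjI)
  with assms show ?thesis
    by (simp add: geodesic_joining_def model_curve_def)
qed

section \<open>Velocity, causal character and length of model curves\<close>

lemma model_curve_velocity:
  assumes "\<And>t. t \<in> {0..1} \<Longrightarrow> \<gamma> t = model_curve x y \<theta> t" and "t \<in> {0..1}"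
  obtains c where
    "(\<gamma> has_vector_derivative (model_vx x y \<theta> t, model_vy x y \<theta> t, c)) (at t within {0..1})"
    "horizontal (\<gamma> t) (model_vx x y \<theta> t, model_vy x y \<theta> t, c)"
proof -
  let ?a = "model_vx x y \<theta> t" and ?b = "model_vy x y \<theta> t"
  obtain u v w where g: "model_curve x y \<theta> t = (u, v, w)"
    by (metis prod_cases3)
  \<comment> \<open>Horizontality forces this value: it is the third component of
    \<open>a X + b Y\<close> at the point \<open>(u, v, w)\<close>, with \<open>a\<close> and
    \<open>b\<close> the first two velocity components.\<close>
  define c where "c = (v * ?a - u * ?b) / 2"
  have uv: "u = ((x + y) * profile (- \<theta>) t + (x - y) * profile \<theta> t) / 2"
    "v = ((x + y) * profile (- \<theta>) t - (x - y) * profile \<theta> t) / 2"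
    using g by (auto simp: model_curve_def)
  have "(model_curve x y \<theta> has_vector_derivative (?a, ?b, c)) (at t within {0..1})"
    unfolding model_curve_def[abs_def] c_def uv
    by (intro has_vector_derivative_Pair
        has_real_derivative_iff_has_vector_derivative[THEN iffD1]
        model_curve_derivs model_z_deriv)
  then have "(\<gamma> has_vector_derivative (?a, ?b, c)) (at t within {0..1})"
    by (rule has_vector_derivative_transform[OF assms(2), rotated]) (use assms in auto)
  moreover have "horizontal (\<gamma> t) (?a, ?b, c)"
  proof -
    have "(?a, ?b, c) = ?a *\<^sub>R X (\<gamma> t) + ?b *\<^sub>R Y (\<gamma> t)"
      using assms g by (simp add: c_def field_simps)
    then show ?thesis
      unfolding horizontal_def by (simp add: span_add span_base span_scale)
  qed
  ultimately show thesis ..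
qed

text \<open>The difference of squares is the product of the two light-cone velocities, whose
  exponentials are reciprocal. So the speed is constant in \<open>t\<close>.\<close>

lemma model_velocity_square:
  "(model_vx x y \<theta> t)\<^sup>2 - (model_vy x y \<theta> t)\<^sup>2 = (x\<^sup>2 - y\<^sup>2) * (slope \<theta> * slope (- \<theta>))"
proof -
  have "(model_vx x y \<theta> t)\<^sup>2 - (model_vy x y \<theta> t)\<^sup>2 =
      ((x + y) * (slope (- \<theta>) * exp (- \<theta> * t))) * ((x - y) * (slope \<theta> * exp (\<theta> * t)))"
    by (simp add: model_vx_def model_vy_def field_simps power2_eq_square)
  also have "\<dots> = (x\<^sup>2 - y\<^sup>2) * (slope \<theta> * slope (- \<theta>)) * (exp (- \<theta> * t) * exp (\<theta> * t))"
    by (simp add: power2_eq_square algebra_simps)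
  also have "exp (- \<theta> * t) * exp (\<theta> * t) = 1"
    by (simp flip: exp_add)
  finally show ?thesis by simp
qed

text \<open>Since \<open>\<bar>y\<bar> < \<bar>x\<bar>\<close>, both \<open>x + y\<close> and
  \<open>x - y\<close> have the sign of \<open>x\<close>, and \<open>model_vx\<close> combines them
  with positive weights.\<close>

lemma model_vx_sign:
  assumes "y\<^sup>2 < x\<^sup>2"
  shows "x > 0 \<Longrightarrow> model_vx x y \<theta> t > 0" and "x < 0 \<Longrightarrow> model_vx x y \<theta> t < 0"
proof -
  have "\<bar>y\<bar> < \<bar>x\<bar>"
    using assms abs_le_square_iff[of x y] by linarith
  moreover have "slope (- \<theta>) * exp (- \<theta> * t) > 0" "slope \<theta> * exp (\<theta> * t) > 0"
    by (simp_all add: slope_pos)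
  moreover have "x > 0 \<Longrightarrow> x + y > 0 \<and> x - y > 0" "x < 0 \<Longrightarrow> x + y < 0 \<and> x - y < 0"
    using calculation(1) by linarith+
  ultimately show "x > 0 \<Longrightarrow> model_vx x y \<theta> t > 0" "x < 0 \<Longrightarrow> model_vx x y \<theta> t < 0"
    unfolding model_vx_def by (simp_all add: add_pos_pos add_neg_neg mult_neg_pos)
qed

lemma model_curve_timelike:
  assumes "y\<^sup>2 < x\<^sup>2" and "\<And>t. t \<in> {0..1} \<Longrightarrow> \<gamma> t = model_curve x y \<theta> t"
  shows "x > 0 \<Longrightarrow> timelike_future_curve \<gamma>" and "x < 0 \<Longrightarrow> timelike_past_curve \<gamma>"
proof -
  \<comment> \<open>Pairing with \<open>X\<close> gives minus the first component, so both time
    orientations reduce to the sign of \<open>model_vx\<close>.\<close>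
  have *: "\<exists>v. (\<gamma> has_vector_derivative v) (at t within {0..1}) \<and> timelike (\<gamma> t) v \<and>
      Q v (X (\<gamma> t)) = - model_vx x y \<theta> t" if t: "t \<in> {0..1}" for t
  proof -
    obtain c where c:
      "(\<gamma> has_vector_derivative (model_vx x y \<theta> t, model_vy x y \<theta> t, c)) (at t within {0..1})"
      "horizontal (\<gamma> t) (model_vx x y \<theta> t, model_vy x y \<theta> t, c)"
      using model_curve_velocity[OF assms(2) t] by blast
    have "(model_vx x y \<theta> t)\<^sup>2 - (model_vy x y \<theta> t)\<^sup>2 > 0"
      unfolding model_velocity_square using assms(1) slope_pos by simp
    then show ?thesis
      using c by (cases "\<gamma> t") (fastforce simp: timelike_def power2_eq_square)
  qed
  show "x > 0 \<Longrightarrow> timelike_future_curve \<gamma>"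
    unfolding timelike_future_curve_def future_directed_def
    using * model_vx_sign(1)[OF assms(1)] by (metis neg_less_0_iff_less)
  show "x < 0 \<Longrightarrow> timelike_past_curve \<gamma>"
    unfolding timelike_past_curve_def past_directed_def
    using * model_vx_sign(2)[OF assms(1)] by (metis neg_0_less_iff_less)
qed

lemma model_curve_length:
  assumes "y\<^sup>2 < x\<^sup>2" and "\<And>t. t \<in> {0..1} \<Longrightarrow> \<gamma> t = model_curve x y \<theta> t"
  shows "(curve_length \<gamma>)\<^sup>2 = (x\<^sup>2 - y\<^sup>2) * (slope \<theta> * slope (- \<theta>))"
proof -
  let ?K = "(x\<^sup>2 - y\<^sup>2) * (slope \<theta> * slope (- \<theta>))"
  have K: "?K > 0"
    using assms(1) slope_pos by simp
  have "curve_length \<gamma> = integral {0..1} (\<lambda>t::real. ?K powr (1/2))"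
    unfolding curve_length_def
  proof (rule integral_cong)
    fix t :: real assume t: "t \<in> {0..1}"
    obtain c where
      "(\<gamma> has_vector_derivative (model_vx x y \<theta> t, model_vy x y \<theta> t, c)) (at t within {0..1})"
      using model_curve_velocity[OF assms(2) t] by blast
    then have "vector_derivative \<gamma> (at t within {0..1}) = (model_vx x y \<theta> t, model_vy x y \<theta> t, c)"
      using t vector_derivative_within_cbox[of 0 1 t] by simp
    moreover have "\<bar>- (model_vx x y \<theta> t * model_vx x y \<theta> t)
        + model_vy x y \<theta> t * model_vy x y \<theta> t\<bar> = ?K"
      using model_velocity_square[of x y \<theta> t] K by (simp add: power2_eq_square)
    ultimately show "(let v = vector_derivative \<gamma> (at t within {0..1}) in \<bar>Q v v\<bar> powr (1/2))
        = ?K powr (1/2)"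
      by (simp add: Let_def)
  qed
  also have "\<dots> = sqrt ?K"
    using K by (simp add: powr_half_sqrt)
  finally show ?thesis
    using K by simp
qed

section \<open>The end height as a bijection onto the open unit interval\<close>

lemma height_minus: "height (- \<theta>) t = - height \<theta> t"
  by (simp add: height_def minus_divide_left)

lemma sinh_gt_self: "sinh s > s" if "s > 0" for s :: real
proof -
  have "sinh 0 - 0 < sinh s - s"
  proof (rule DERIV_pos_imp_increasing_open[OF that])
    fix x :: real assume "0 < x" "x < s"
    then show "\<exists>y. ((\<lambda>s. sinh s - s) has_real_derivative y) (at x) \<and> 0 < y"
      using cosh_minus_1_pos[of x]
      by (intro exI[of _ "cosh x - 1"]) (auto intro!: derivative_eq_intros)
  qed (auto intro!: continuous_intros)
  then show ?thesis by simp
qed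

lemma height_pos: "height \<theta> 1 > 0" if "\<theta> > 0"
  using that sinh_gt_self[OF that] cosh_minus_1_pos[of \<theta>] by (simp add: height_def)

text \<open>This makes the numerator of the derivative of \<open>height \<theta> 1\<close> positive.
  Half-angle formulas reduce it to \<open>sinh s < s * cosh s\<close> at
  \<open>s = \<theta> / 2\<close>, and \<open>s * cosh s - sinh s\<close> increases because its
  derivative is \<open>s * sinh s\<close>.\<close>

lemma self_mult_sinh_gt: "\<theta> * sinh \<theta> > 2 * (cosh \<theta> - 1)" if "\<theta> > 0" for \<theta> :: real
proof -
  have "sinh s < s * cosh s" if "s > 0" for s :: real
  proof -
    have "0 * cosh 0 - sinh 0 < s * cosh s - sinh s"
    proof (rule DERIV_pos_imp_increasing_open[OF that])
      fix x :: real assume "0 < x" "x < s"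
      then show "\<exists>y. ((\<lambda>s. s * cosh s - sinh s) has_real_derivative y) (at x) \<and> 0 < y"
        by (intro exI[of _ "x * sinh x"]) (auto intro!: derivative_eq_intros)
    qed (auto intro!: continuous_intros)
    then show ?thesis by simp
  qed
  from this[of "\<theta> / 2"] that
  have "4 * sinh (\<theta> / 2) * sinh (\<theta> / 2) < 4 * sinh (\<theta> / 2) * (\<theta> / 2 * cosh (\<theta> / 2))"
    by (intro mult_strict_left_mono) auto
  moreover have "sinh \<theta> = 2 * sinh (\<theta> / 2) * cosh (\<theta> / 2)"
    using sinh_double[of "\<theta> / 2"] by simp
  moreover have "cosh \<theta> = 1 + 2 * sinh (\<theta> / 2) * sinh (\<theta> / 2)"
    using cosh_double[of "\<theta> / 2"] cosh_square_eq[of "\<theta> / 2"] by (simp add: power2_eq_square)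
  ultimately show ?thesis by (simp add: algebra_simps)
qed

lemma height_strict_mono: "height a 1 < height b 1" if "0 < a" "a < b"
proof -
  have "((\<lambda>\<theta>. height \<theta> 1) has_real_derivative
      (\<theta> * sinh \<theta> - 2 * (cosh \<theta> - 1)) / (cosh \<theta> - 1)\<^sup>2) (at \<theta>)" if "\<theta> > 0" for \<theta>
  proof -
    have *: "cosh \<theta> \<noteq> 1" using cosh_minus_1_pos[of \<theta>] that by simp
    show ?thesis
      unfolding height_def using *
      by (auto intro!: derivative_eq_intros simp: power2_eq_square)
        (use cosh_square_eq[of \<theta>] in \<open>simp add: algebra_simps power2_eq_square\<close>)
  qed
  moreover have "(\<theta> * sinh \<theta> - 2 * (cosh \<theta> - 1)) / (cosh \<theta> - 1)\<^sup>2 > 0" if "\<theta> > 0" for \<theta> :: real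
    using self_mult_sinh_gt[OF that] cosh_minus_1_pos[of \<theta>] that by simp
  ultimately show ?thesis
    using that by (intro DERIV_pos_imp_increasing[OF \<open>a < b\<close>]) (metis dual_order.strict_trans1)
qed

text \<open>The end height has the sign of the angle, so equal heights mean angles of equal sign.
  Monotonicity settles positive angles and oddness the negative ones.\<close>

lemma height_inj:
  assumes "height a 1 = height b 1"
  shows "a = b"
proof -
  have pos: "c = d" if "height c 1 = height d 1" "c > 0" "d > 0" for c d
    using height_strict_mono[of c d] height_strict_mono[of d c] that by fastforce
  have neg: "height c 1 < 0" if "c < 0" for c
    using height_pos[of "- c"] that by (simp add: height_minus)
  consider "a > 0" | "a = 0" | "a < 0" by linarith
  then show ?thesis
  proof cases
    case 1
    then have "b > 0"
      using assms height_pos[of a] neg[of b] by (cases b "0::real" rule: linorder_cases) auto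
    with 1 show ?thesis using pos assms by blast
  next
    case 2
    then show ?thesis
      using assms height_pos[of b] neg[of b] by (cases b "0::real" rule: linorder_cases) auto
  next
    case 3
    then have "b < 0"
      using assms height_pos[of b] neg[of a] by (cases b "0::real" rule: linorder_cases) auto
    with 3 show ?thesis using pos[of "- a" "- b"] assms by (simp add: height_minus)
  qed
qed

text \<open>For positive \<open>w\<close> the intermediate value theorem applies between the limits
  0 at \<open>0\<close> and 1 at infinity; oddness gives negative \<open>w\<close>.\<close>

lemma height_surj:
  assumes "\<bar>w\<bar> < 1"
  obtains \<theta> where "height \<theta> 1 = w"
proof -
  have *: "\<exists>\<theta>. height \<theta> 1 = w" if w: "0 < w" "w < 1" for w
  proof -
    have "((\<lambda>\<theta>. height \<theta> 1) \<longlongrightarrow> 0) (at_right 0)"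
      unfolding height_def sinh_field_def cosh_field_def by real_asymp
    from order_tendstoD(2)[OF this w(1)] obtain d where d: "d > 0" "\<And>\<theta>. 0 < \<theta> \<Longrightarrow> \<theta> < d \<Longrightarrow> height \<theta> 1 < w"
      by (auto simp: eventually_at_right_field)
    have "((\<lambda>\<theta>. height \<theta> 1) \<longlongrightarrow> 1) at_top"
      unfolding height_def sinh_field_def cosh_field_def by real_asymp
    from order_tendstoD(1)[OF this w(2)] obtain N where N: "\<And>\<theta>. N \<le> \<theta> \<Longrightarrow> height \<theta> 1 > w"
      by (auto simp: eventually_at_top_linorder)
    \<comment> \<open>Starting at \<open>d / 2\<close> keeps the denominator
      \<open>cosh \<theta> - 1\<close> nonzero on the interval, and the maximum keeps the interval
      nonempty.\<close>
    have "\<exists>\<theta>\<ge>d / 2. \<theta> \<le> max N (d / 2) \<and> height \<theta> 1 = w"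
    proof (rule IVT')
      show "height (d / 2) 1 \<le> w" using d by (simp add: less_imp_le)
      show "w \<le> height (max N (d / 2)) 1" using N by (simp add: less_imp_le)
      have "cosh \<theta> \<noteq> 1" if "\<theta> \<ge> d / 2" for \<theta>
        using cosh_minus_1_pos[of \<theta>] that d by force
      then show "continuous_on {d / 2..max N (d / 2)} (\<lambda>\<theta>. height \<theta> 1)"
        unfolding height_def by (auto intro!: continuous_intros)
    qed simp
    then show ?thesis by blast
  qed
  consider "w > 0" | "w = 0" | "w < 0" by linarith
  then have "\<exists>\<theta>. height \<theta> 1 = w"
  proof cases
    case 3
    then obtain \<theta> where "height \<theta> 1 = - w"
      using *[of "- w"] assms by auto
    then have "height (- \<theta>) 1 = w" by (simp add: height_minus)
    then show ?thesis ..
  qed (use * assms in \<open>auto intro: exI[of _ 0]\<close>)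
  then show thesis using that by blast
qed

section \<open>Translation into the closed formulas\<close>

text \<open>Half-angle formulas give the identity away from 0. The minus sign matches the
  denominator \<open>- x\<^sup>2 + y\<^sup>2\<close>, so the angle equation says that the model
  curve with momentum \<open>\<bar>\<theta>\<bar>\<close> ends at height \<open>z\<close>.\<close>

lemma angle_function_eq_height:
  "cont_ext (\<lambda>\<theta>. (\<bar>\<theta>\<bar>/2) / (sinh (\<bar>\<theta>\<bar>/2))\<^sup>2 - coth (\<bar>\<theta>\<bar>/2)) \<theta> = - height \<bar>\<theta>\<bar> 1"
proof (cases "\<theta> = 0")
  case True
  then show ?thesis using angle_function_0 by simp
next
  case False
  define u where "u = \<bar>\<theta>\<bar> / 2"
  have u: "\<bar>\<theta>\<bar> = 2 * u" "u > 0" using False by (auto simp: u_def)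
  have "cosh (2 * u) - 1 = 2 * (sinh u)\<^sup>2"
    using cosh_double[of u] cosh_square_eq[of u] by simp
  then have h: "height \<bar>\<theta>\<bar> 1 = (2 * sinh u * cosh u - 2 * u) / (2 * (sinh u)\<^sup>2)"
    using u(1) sinh_double[of u] by (simp add: height_def)
  show ?thesis
    unfolding h cont_ext_def u_def[symmetric] coth_def
    using False u(2) by (simp add: field_simps power2_eq_square)
qed

text \<open>Negative \<open>a\<close> is included, so that the formula also covers
  \<open>profile (- \<theta>)\<close>.\<close>

lemma profile_half_angle:
  "profile (2 * a) t = exp (a * t) * sinh (a * t) / (exp a * sinh a)" if "a \<noteq> 0"
proof -
  have *: "exp (2 * a) - 1 = 2 * exp a * sinh a" for a :: real
  proof -
    have "exp (2 * a) = exp a * exp a"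
      by (simp add: exp_double power2_eq_square)
    moreover have "exp a * exp (- a) = 1"
      by (simp flip: exp_add)
    ultimately show ?thesis
      by (simp add: sinh_field_def algebra_simps)
  qed
  show ?thesis
    using that *[of a] *[of "a * t"] by (simp add: profile_def mult.assoc)
qed

lemma model_x_half_angle:
  assumes "a > 0" "s = 2 * a"
  shows "((x + y) * profile (- s) t + (x - y) * profile s t) / 2 =
    (sinh (a * t))\<^sup>2 * (x * (coth (a * t) * coth a - 1) + y * (coth (a * t) - coth a))"
proof (cases "t = 0")
  case False
  have nz: "sinh a \<noteq> 0" "sinh (a * t) \<noteq> 0"
    using assms False by auto
  have p: "profile s t = exp (a * t) * exp (- a) * sinh (a * t) / sinh a"
    and m: "profile (- s) t = exp (- (a * t)) * exp a * sinh (a * t) / sinh a"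
  proof -
    have shift: "A * B / (C * D) = A * C' * B / D" if "C * C' = 1" for A B C C' D :: real
    proof -
      have "C \<noteq> 0" using that by auto
      then have "C' = 1 / C" using that by (simp add: eq_divide_eq mult.commute)
      then show ?thesis by simp
    qed
    have "profile s t = exp (a * t) * sinh (a * t) / (exp a * sinh a)"
      using assms profile_half_angle[of a t] by simp
    then show "profile s t = exp (a * t) * exp (- a) * sinh (a * t) / sinh a"
      using shift[of "exp a" "exp (- a)"] by (simp flip: exp_add)
    have "profile (- s) t = exp (- (a * t)) * sinh (a * t) / (exp (- a) * sinh a)"
      using assms profile_half_angle[of "- a" t] by simp
    then show "profile (- s) t = exp (- (a * t)) * exp a * sinh (a * t) / sinh a"
      using shift[of "exp (- a)" "exp a"] by (simp flip: exp_add)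
  qed
  \<comment> \<open>Here \<open>c\<close>, \<open>s\<close> stand for \<open>cosh\<close> and
    \<open>sinh\<close> of \<open>a * t\<close>, and \<open>C\<close>, \<open>S\<close> for those of
    \<open>a\<close>. Each exponential is a sum or difference of these, which leaves a rational
    identity.\<close>
  have clear_denominators: "((x + y) * ((c - s) * (C + S) * s / S) + (x - y) * ((c + s) * (C - S) * s / S)) / 2
      = s\<^sup>2 * (x * (c / s * (C / S) - 1) + y * (c / s - C / S))"
    if "S \<noteq> 0" "s \<noteq> 0" for c s C S :: real
  proof -
    have "((x + y) * ((c - s) * (C + S) * s / S) + (x - y) * ((c + s) * (C - S) * s / S)) / 2
      = s / S * (((x + y) * ((c - s) * (C + S)) + (x - y) * ((c + s) * (C - S))) / 2)"
      using that by (simp add: divide_simps) (simp add: algebra_simps)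
    also have "((x + y) * ((c - s) * (C + S)) + (x - y) * ((c + s) * (C - S))) / 2
      = x * (c * C - s * S) + y * (c * S - s * C)"
      by (simp add: field_simps)
    also have "s / S * \<dots> = s\<^sup>2 * (x * (c / s * (C / S) - 1) + y * (c / s - C / S))"
      using that by (simp add: divide_simps power2_eq_square)
    finally show ?thesis .
  qed
  have e: "exp (a * t) = cosh (a * t) + sinh (a * t)" "exp (- (a * t)) = cosh (a * t) - sinh (a * t)"
    "exp a = cosh a + sinh a" "exp (- a) = cosh a - sinh a"
    by (simp_all add: cosh_plus_sinh cosh_minus_sinh)
  show ?thesis
    unfolding p m e coth_def by (rule clear_denominators[OF nz])
qed simp

lemma geo_x_eq: "geo_x x y \<theta> t = ((x + y) * profile (- \<bar>\<theta>\<bar>) t + (x - y) * profile \<bar>\<theta>\<bar> t) / 2"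
proof (cases "\<theta> = 0")
  case True
  then show ?thesis by (simp add: geo_x_0 profile_def algebra_simps)
next
  case False
  then show ?thesis
    using model_x_half_angle[of "\<bar>\<theta>\<bar> / 2" "\<bar>\<theta>\<bar>" x y t]
    unfolding geo_x_def cont_ext_def by (simp only: if_False)
qed

text \<open>Exchanging \<open>x\<close> and \<open>y\<close> turns \<open>geo_x\<close> into
  \<open>geo_y\<close>, preserves \<open>x + y\<close> and changes the sign of
  \<open>x - y\<close>.\<close>

lemma geo_y_eq: "geo_y x y \<theta> t = ((x + y) * profile (- \<bar>\<theta>\<bar>) t - (x - y) * profile \<bar>\<theta>\<bar> t) / 2"
  using geo_x_eq[of y x \<theta> t] by (simp add: geo_x_def geo_y_def algebra_simps)

text \<open>For \<open>\<theta> = 0\<close> the assumption forces \<open>z = 0\<close>. Otherwise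
  \<open>z\<close> is \<open>d / 4\<close> times the end height, whose numerator cancels the
  denominator of \<open>geo_z\<close>.\<close>

lemma geo_z_eq:
  assumes "d * height \<bar>\<theta>\<bar> 1 = 4 * z"
  shows "geo_z z \<theta> t = d / 4 * height \<bar>\<theta>\<bar> t"
proof (cases "\<theta> = 0")
  case True
  then show ?thesis using assms by (simp add: geo_z_0)
next
  case False
  define s where "s = \<bar>\<theta>\<bar>"
  have s: "sinh s - s \<noteq> 0"
    using sinh_gt_self[of s] False by (auto simp: s_def)
  have "(s * t - sinh (s * t)) / (s - sinh s) = (sinh (s * t) - s * t) / (sinh s - s)"
    using minus_divide_divide[of "sinh (s * t) - s * t" "sinh s - s"] by simp
  moreover have "z = d / 4 * height s 1"
    using assms by (simp add: s_def)
  ultimately have "z * ((s * t - sinh (s * t)) / (s - sinh s)) = d / 4 * height s t"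
    using s by (simp add: height_def)
  then show ?thesis
    using False by (simp add: geo_z_def cont_ext_def s_def)
qed

text \<open>By the angle equation, \<open>d + 4 * \<bar>z\<bar>\<close> contains the factor
  \<open>(sinh s - s) + (cosh s - 1)\<close> with \<open>s = \<bar>\<theta>\<bar>\<close>. This is
  also the bracket in the denominator, and cancelling it leaves \<open>d\<close> times the product
  in \<open>slope_mult\<close>.\<close>

lemma length_formula_eq:
  assumes "d > 0" "d * height \<bar>\<theta>\<bar> 1 = 4 * z"
  shows "cont_ext (\<lambda>\<theta>. \<theta>\<^sup>2 * ((\<bar>- d\<bar> + 4 * \<bar>z\<bar>) /
      (2 * (\<bar>\<bar>\<theta>\<bar> - sinh \<bar>\<theta>\<bar>\<bar> + 2 * (sinh (\<bar>\<theta>\<bar>/2))\<^sup>2)))) \<theta> = d * (slope \<bar>\<theta>\<bar> * slope (- \<bar>\<theta>\<bar>))"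
proof (cases "\<theta> = 0")
  case True
  then show ?thesis
    unfolding True length_formula_0 using assms True by (simp add: slope_def)
next
  case False
  define s where "s = \<bar>\<theta>\<bar>"
  have s: "s > 0" "\<theta>\<^sup>2 = s\<^sup>2" using False by (auto simp: s_def)
  have c: "2 * (sinh (s / 2))\<^sup>2 = cosh s - 1"
    using cosh_double[of "s / 2"] cosh_square_eq[of "s / 2"] by simp
  have c0: "cosh s - 1 > 0" using cosh_minus_1_pos s by simp
  \<comment> \<open>The height at a positive angle is positive, so the angle equation puts
    \<open>z\<close> on the nonnegative side and \<open>\<bar>z\<bar>\<close> is
    \<open>z\<close>.\<close>
  have "d * height \<bar>\<theta>\<bar> 1 > 0"
    using assms(1) height_pos[OF s(1)] by (simp add: s_def)
  then have "z \<ge> 0"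
    using assms(2) by linarith
  then have "4 * \<bar>z\<bar> = d * ((sinh s - s) / (cosh s - 1))"
    using assms by (simp add: height_def s_def)
  then have z: "d + 4 * \<bar>z\<bar> = d * ((sinh s - s) + (cosh s - 1)) / (cosh s - 1)"
  proof -
    have aux: "d + d * (S / C) = d * (S + C) / C" if "C \<noteq> 0" for S C :: real
      using that by (simp add: field_simps)
    show ?thesis
      unfolding \<open>4 * \<bar>z\<bar> = _\<close> by (rule aux) (use s in simp)
  qed
  have ss: "\<bar>s - sinh s\<bar> = sinh s - s" using sinh_gt_self[OF s(1)] by simp
  have pos: "(sinh s - s) + (cosh s - 1) > 0" using sinh_gt_self[OF s(1)] c0 by simp
  have "\<theta>\<^sup>2 * ((\<bar>- d\<bar> + 4 * \<bar>z\<bar>) / (2 * (\<bar>s - sinh s\<bar> + 2 * (sinh (s/2))\<^sup>2)))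
      = d * (s\<^sup>2 / (2 * (cosh s - 1)))"
  proof -
    have cancel: "q * ((d * P / C) / (2 * P)) = d * (q / (2 * C))" if "P \<noteq> 0" for q P C :: real
      using that by (simp add: mult.commute)
    have abs: "\<bar>- d\<bar> = d"
      using assms(1) by simp
    then show ?thesis
      unfolding c ss s(2) abs z by (intro cancel) (use pos in simp)
  qed
  then show ?thesis
    using False unfolding cont_ext_def slope_mult s_def by simp
qed

section \<open>Existence, uniqueness and the formulas for a given end point\<close>

theorem theorem3:
  fixes x y z :: real
  assumes "- x\<^sup>2 + y\<^sup>2 < 0"
    and "4 * \<bar>z\<bar> / (x\<^sup>2 - y\<^sup>2) < 1"
  shows
    "(x > 0 \<longrightarrow> (\<exists>!\<gamma>. \<gamma> \<in> extensional {0..1} \<and>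
        geodesic_joining (0, 0, 0) (x, y, z) \<gamma> \<and> timelike_future_curve \<gamma>)) \<and>
     (x < 0 \<longrightarrow> (\<exists>!\<gamma>. \<gamma> \<in> extensional {0..1} \<and>
        geodesic_joining (0, 0, 0) (x, y, z) \<gamma> \<and> timelike_past_curve \<gamma>)) \<and>
     (\<forall>\<theta> \<gamma>.
        4 * z / (- x\<^sup>2 + y\<^sup>2) =
          cont_ext (\<lambda>\<theta>. (\<bar>\<theta>\<bar>/2) / (sinh (\<bar>\<theta>\<bar>/2))\<^sup>2 - coth (\<bar>\<theta>\<bar>/2)) \<theta> \<longrightarrow>
        geodesic_joining (0, 0, 0) (x, y, z) \<gamma> \<longrightarrow>
        (x > 0 \<and> timelike_future_curve \<gamma>) \<or> (x < 0 \<and> timelike_past_curve \<gamma>) \<longrightarrow>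
        (\<forall>t\<in>{0..1}. \<gamma> t = (geo_x x y \<theta> t, geo_y x y \<theta> t, geo_z z \<theta> t)) \<and>
        (curve_length \<gamma>)\<^sup>2 =
          cont_ext (\<lambda>\<theta>. \<theta>\<^sup>2 * ((\<bar>- x\<^sup>2 + y\<^sup>2\<bar> + 4 * \<bar>z\<bar>) /
            (2 * (\<bar>\<bar>\<theta>\<bar> - sinh \<bar>\<theta>\<bar>\<bar> + 2 * (sinh (\<bar>\<theta>\<bar>/2))\<^sup>2)))) \<theta>)"
proof -
  define d where "d = x\<^sup>2 - y\<^sup>2"
  have d: "d > 0" "y\<^sup>2 < x\<^sup>2" "- x\<^sup>2 + y\<^sup>2 = - d"
    using assms(1) by (auto simp: d_def)
  have "\<bar>4 * z / d\<bar> < 1"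
    using assms(2) d(1) by (simp add: abs_mult d_def)
  then obtain \<theta> where "height \<theta> 1 = 4 * z / d"
    by (rule height_surj)
  then have \<theta>: "d * height \<theta> 1 = 4 * z"
    using d(1) by simp
  \<comment> \<open>All geodesics to the end point share this \<open>\<theta>\<close>: their third
    coordinates at 1 agree and the end height is injective. Uniqueness thus holds before time
    orientation enters.\<close>
  have char: "\<gamma> t = model_curve x y \<theta> t"
    if g: "geodesic_joining (0, 0, 0) (x, y, z) \<gamma>" and t: "t \<in> {0..1}" for \<gamma> t
  proof -
    obtain \<theta>' where *: "\<And>t. t \<in> {0..1} \<Longrightarrow> \<gamma> t = model_curve x y \<theta>' t"
      using geodesic_imp_model_curve[OF g] by blast
    have "d * height \<theta>' 1 = d * height \<theta> 1"
      using *[of 1] g \<theta> by (simp add: geodesic_joining_def model_curve_def d_def)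
    then have "height \<theta>' 1 = height \<theta> 1"
      using d(1) by simp
    with *[OF t] show ?thesis
      using height_inj by blast
  qed
  \<comment> \<open>Restriction gives the curve a fixed value outside the unit interval, so
    uniqueness becomes equality of functions.\<close>
  define \<gamma>0 where "\<gamma>0 = restrict (model_curve x y \<theta>) {0..1}"
  have \<gamma>0: "\<And>t. t \<in> {0..1} \<Longrightarrow> \<gamma>0 t = model_curve x y \<theta> t"
    by (simp add: \<gamma>0_def)
  have geo: "geodesic_joining (0, 0, 0) (x, y, z) \<gamma>0"
    by (rule model_curve_geodesic[OF \<gamma>0]) (use \<theta> d_def in auto)
  have uniq: "\<gamma> = \<gamma>0"
    if "\<gamma> \<in> extensional {0..1}" "geodesic_joining (0, 0, 0) (x, y, z) \<gamma>" for \<gamma>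
    by (rule extensionalityI[OF that(1)]) (use char[OF that(2)] \<gamma>0 in \<open>auto simp: \<gamma>0_def\<close>)
  have "\<gamma>0 \<in> extensional {0..1}"
    by (simp add: \<gamma>0_def)
  note ex = this geo model_curve_timelike[OF d(2) \<gamma>0]
  have formula: "(\<forall>t\<in>{0..1}. \<gamma> t = (geo_x x y \<phi> t, geo_y x y \<phi> t, geo_z z \<phi> t)) \<and>
        (curve_length \<gamma>)\<^sup>2 =
          cont_ext (\<lambda>\<theta>. \<theta>\<^sup>2 * ((\<bar>- x\<^sup>2 + y\<^sup>2\<bar> + 4 * \<bar>z\<bar>) /
            (2 * (\<bar>\<bar>\<theta>\<bar> - sinh \<bar>\<theta>\<bar>\<bar> + 2 * (sinh (\<bar>\<theta>\<bar>/2))\<^sup>2)))) \<phi>"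
    if eq: "4 * z / (- x\<^sup>2 + y\<^sup>2) =
        cont_ext (\<lambda>\<theta>. (\<bar>\<theta>\<bar>/2) / (sinh (\<bar>\<theta>\<bar>/2))\<^sup>2 - coth (\<bar>\<theta>\<bar>/2)) \<phi>"
      and g: "geodesic_joining (0, 0, 0) (x, y, z) \<gamma>" for \<phi> \<gamma>
  proof -
    \<comment> \<open>A solution \<open>\<phi>\<close> of the angle equation enters only through
      \<open>\<bar>\<phi>\<bar>\<close>, which injectivity then identifies with the signed momentum
      \<open>\<theta>\<close>.\<close>
    have \<phi>: "d * height \<bar>\<phi>\<bar> 1 = 4 * z"
      using eq d(1) unfolding angle_function_eq_height d(3) by (simp add: field_simps)
    then have "d * height \<theta> 1 = d * height \<bar>\<phi>\<bar> 1"
      using \<theta> by simp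
    then have "\<theta> = \<bar>\<phi>\<bar>"
      using d(1) by (intro height_inj[of \<theta> "\<bar>\<phi>\<bar>"]) simp
    with char[OF g] have m: "\<And>t. t \<in> {0..1} \<Longrightarrow> \<gamma> t = model_curve x y \<bar>\<phi>\<bar> t"
      by simp
    show ?thesis
      using m model_curve_length[OF d(2) m]
      unfolding d(3) length_formula_eq[OF d(1) \<phi>] geo_x_eq geo_y_eq geo_z_eq[OF \<phi>]
      by (simp add: model_curve_def d_def)
  qed
  show ?thesis
    using ex uniq formula by blast
qed

end
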